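(* Let $n\ge k\ge 1$ be integers and let $X_1,\dots,X_n$ be arbitrary mutually independent non-negative random variables with finite expectations. Let $\mathcal{A}^*$ be the optimal expected maximum value sampled by an adaptive probing policy probing $k$ of these variables, and let $\mathcal{S}^*=\max_{S\subseteq[n],\,|S|=k}\mathbb{E}[\max_{i\in S}X_i]$. Then $\mathcal{A}^*/\mathcal{S}^*\le 2$ (that is, $\mathcal{A}^*\le 2\mathcal{S}^*$).
   Context: An adaptive probing policy is a function $P$ that, given a state $(\kappa,r,T)$ with $\kappa\in\{1,\dots,k\}$ (probes remaining), $r\ge0$ (maximal value sampled so far), $T\subseteq[n]$ (indices not yet probed), returns an index $P(\kappa,r,T)\in T$ to probe next. Starting from state $(k,0,[n])$, it probes $X_{P(\kappa,r,T)}$, observes its value, and moves to $(\kappa-1,\max\{r,X_{P(\kappa,r,T)}\},T\setminus\{P(\kappa,r,T)\})$; at a state $(0,r,T)$ it stops with reward $r$. $\mathcal{A}^*$ is the maximum over all such policies of the expected reward. *)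

theory Defs
  imports "HOL-Probability.Probability"
begin

type_synonym policy = "nat \<Rightarrow> real \<Rightarrow> nat set \<Rightarrow> nat"

text \<open>
  A policy maps a state \<open>(\<kappa>, r, T)\<close> to an element of \<open>T\<close>. There is none when \<open>T\<close> is empty; such
  states are never reached with \<open>\<kappa> \<ge> 1\<close> when \<open>k \<le> n\<close>. Measurability in the real component
  of the state is what makes the reward a random variable, so that its expectation is meaningful.
\<close>

definition adaptive_policies :: "nat \<Rightarrow> nat \<Rightarrow> policy set" where
  "adaptive_policies n k =
    {P. \<forall>\<kappa>\<in>{1..k}. \<forall>T. T \<subseteq> {1..n} \<and> T \<noteq> {} \<longrightarrow>
          (\<forall>r\<ge>0. P \<kappa> r T \<in> T) \<and>
          (\<lambda>r. P \<kappa> r T) \<in> measurable (restrict_space borel {0..}) (count_space UNIV)}"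

fun probe_reward :: "policy \<Rightarrow> (nat \<Rightarrow> real) \<Rightarrow> nat \<Rightarrow> real \<Rightarrow> nat set \<Rightarrow> real" where
  "probe_reward P x 0 r T = r"
| "probe_reward P x (Suc \<kappa>) r T =
    (let i = P (Suc \<kappa>) r T in probe_reward P x \<kappa> (max r (x i)) (T - {i}))"

definition expected_reward ::
  "'a measure \<Rightarrow> nat \<Rightarrow> nat \<Rightarrow> (nat \<Rightarrow> 'a \<Rightarrow> real) \<Rightarrow> policy \<Rightarrow> real" where
  "expected_reward M n k X P = integral\<^sup>L M (\<lambda>\<omega>. probe_reward P (\<lambda>i. X i \<omega>) k 0 {1..n})"

text \<open>
  The maximum over policies is written as a supremum. For integrable non-negative variables and
  \<open>k \<le> n\<close> it is the supremum of a non-empty bounded set of expectations of integrable rewards;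
  see the lemmas below.
\<close>

definition adaptive_opt :: "'a measure \<Rightarrow> nat \<Rightarrow> nat \<Rightarrow> (nat \<Rightarrow> 'a \<Rightarrow> real) \<Rightarrow> real" where
  "adaptive_opt M n k X = (SUP P\<in>adaptive_policies n k. expected_reward M n k X P)"

definition nonadaptive_opt :: "'a measure \<Rightarrow> nat \<Rightarrow> nat \<Rightarrow> (nat \<Rightarrow> 'a \<Rightarrow> real) \<Rightarrow> real" where
  "nonadaptive_opt M n k X =
    (MAX S\<in>{S. S \<subseteq> {1..n} \<and> card S = k}. integral\<^sup>L M (\<lambda>\<omega>. MAX i\<in>S. X i \<omega>))"

lemma adaptive_policies_nonempty: "adaptive_policies n k \<noteq> {}"
proof -
  have "(\<lambda>\<kappa> r T. Min T) \<in> adaptive_policies n k"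
    by (auto simp: adaptive_policies_def intro!: Min_in intro: finite_subset)
  then show ?thesis by blast
qed

lemma adaptive_policiesD:
  assumes "P \<in> adaptive_policies n k" "1 \<le> \<kappa>" "\<kappa> \<le> k" "T \<subseteq> {1..n}" "\<kappa> \<le> card T"
  shows "r \<ge> 0 \<Longrightarrow> P \<kappa> r T \<in> T"
    and "(\<lambda>r. P \<kappa> r T) \<in> measurable (restrict_space borel {0..}) (count_space UNIV)"
proof -
  have "T \<noteq> {}" using assms by auto
  then show "r \<ge> 0 \<Longrightarrow> P \<kappa> r T \<in> T"
    and "(\<lambda>r. P \<kappa> r T) \<in> measurable (restrict_space borel {0..}) (count_space UNIV)"
    using assms unfolding adaptive_policies_def by auto
qed

lemma probe_reward_bounds:
  assumes "P \<in> adaptive_policies n k" "\<kappa> \<le> k" "T \<subseteq> {1..n}" "\<kappa> \<le> card T" "r \<ge> 0"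
    and nn: "\<And>i. i \<in> {1..n} \<Longrightarrow> 0 \<le> x i"
  shows "0 \<le> probe_reward P x \<kappa> r T \<and> probe_reward P x \<kappa> r T \<le> r + (\<Sum>i\<in>T. x i)"
  using assms(2-5)
proof (induction \<kappa> arbitrary: r T)
  case 0
  then show ?case using nn by (auto intro!: sum_nonneg)
next
  case (Suc \<kappa>)
  define i where "i = P (Suc \<kappa>) r T"
  have i: "i \<in> T" unfolding i_def using adaptive_policiesD(1)[OF assms(1), of "Suc \<kappa>" T r] Suc.prems by auto
  have fin: "finite T" using Suc.prems finite_subset by blast
  have xi: "0 \<le> x i" using i Suc.prems nn by blast
  have "0 \<le> probe_reward P x \<kappa> (max r (x i)) (T - {i}) \<and>
    probe_reward P x \<kappa> (max r (x i)) (T - {i}) \<le> max r (x i) + (\<Sum>i\<in>T - {i}. x i)"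
    using Suc.prems i fin by (intro Suc.IH) auto
  moreover have "(\<Sum>i\<in>T. x i) = x i + (\<Sum>i\<in>T - {i}. x i)" using i fin by (simp add: sum.remove)
  ultimately show ?case using xi Suc.prems by (auto simp: Let_def i_def)
qed

lemma probe_reward_measurable:
  assumes "P \<in> adaptive_policies n k" "\<kappa> \<le> k" "T \<subseteq> {1..n}" "\<kappa> \<le> card T"
    and X: "\<And>i. i \<in> {1..n} \<Longrightarrow> X i \<in> borel_measurable M"
    and R: "R \<in> borel_measurable M" "\<And>\<omega>. \<omega> \<in> space M \<Longrightarrow> 0 \<le> R \<omega>"
  shows "(\<lambda>\<omega>. probe_reward P (\<lambda>i. X i \<omega>) \<kappa> (R \<omega>) T) \<in> borel_measurable M"
  using assms(2-4) R
proof (induction \<kappa> arbitrary: R T)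
  case 0
  then show ?case by simp
next
  case (Suc \<kappa>)
  have fin: "finite T" using Suc.prems finite_subset by blast
  have "R \<in> measurable M (restrict_space borel {0..})"
    using Suc.prems by (auto intro!: measurable_restrict_space2)
  from measurable_compose[OF this adaptive_policiesD(2)[OF assms(1), of "Suc \<kappa>" T]]
  have g: "(\<lambda>\<omega>. P (Suc \<kappa>) (R \<omega>) T) \<in> measurable M (count_space UNIV)"
    using Suc.prems by auto
  have g': "(\<lambda>\<omega>. P (Suc \<kappa>) (R \<omega>) T) \<in> measurable M (count_space T)"
  proof (rule measurable_count_space_extend[OF _ _ g])
    show "(\<lambda>\<omega>. P (Suc \<kappa>) (R \<omega>) T) \<in> space M \<rightarrow> T"
      using Suc.prems adaptive_policiesD(1)[OF assms(1), of "Suc \<kappa>" T] by auto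
  qed auto
  have f: "(\<lambda>\<omega>. probe_reward P (\<lambda>i. X i \<omega>) \<kappa> (max (R \<omega>) (X i \<omega>)) (T - {i})) \<in> borel_measurable M"
    if "i \<in> T" for i
    using Suc.prems that fin X by (intro Suc.IH) (auto simp: le_max_iff_disj)
  show ?case
    unfolding probe_reward.simps Let_def
    by (rule measurable_compose_countable'[OF f g']) (auto intro: countable_finite fin)
qed

lemma
  assumes "k \<le> n" "P \<in> adaptive_policies n k"
    and int: "\<And>i. i \<in> {1..n} \<Longrightarrow> integrable M (X i)"
    and nn: "\<And>i \<omega>. i \<in> {1..n} \<Longrightarrow> \<omega> \<in> space M \<Longrightarrow> 0 \<le> X i \<omega>"
  shows probe_reward_integrable:
      "integrable M (\<lambda>\<omega>. probe_reward P (\<lambda>i. X i \<omega>) k 0 {1..n})"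
    and expected_reward_le: "expected_reward M n k X P \<le> (\<Sum>i\<in>{1..n}. integral\<^sup>L M (X i))"
proof -
  have b: "0 \<le> probe_reward P (\<lambda>i. X i \<omega>) k 0 {1..n} \<and>
      probe_reward P (\<lambda>i. X i \<omega>) k 0 {1..n} \<le> (\<Sum>i\<in>{1..n}. X i \<omega>)" if "\<omega> \<in> space M" for \<omega>
    using probe_reward_bounds[OF assms(2), of k "{1..n}" 0 "\<lambda>i. X i \<omega>"] assms(1) nn that by auto
  have m: "(\<lambda>\<omega>. probe_reward P (\<lambda>i. X i \<omega>) k 0 {1..n}) \<in> borel_measurable M"
    using assms(1) int by (intro probe_reward_measurable[OF assms(2)]) auto
  have s: "integrable M (\<lambda>\<omega>. \<Sum>i\<in>{1..n}. X i \<omega>)" using int by auto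
  show i: "integrable M (\<lambda>\<omega>. probe_reward P (\<lambda>i. X i \<omega>) k 0 {1..n})"
  proof (rule Bochner_Integration.integrable_bound[OF s m], rule AE_I2)
    show "norm (probe_reward P (\<lambda>i. X i \<omega>) k 0 {1..n}) \<le> norm (\<Sum>i\<in>{1..n}. X i \<omega>)"
      if "\<omega> \<in> space M" for \<omega> using b[OF that] by simp
  qed
  have "expected_reward M n k X P \<le> integral\<^sup>L M (\<lambda>\<omega>. \<Sum>i\<in>{1..n}. X i \<omega>)"
    unfolding expected_reward_def using b by (intro integral_mono i s) auto
  also have "\<dots> = (\<Sum>i\<in>{1..n}. integral\<^sup>L M (X i))"
    using int by (intro Bochner_Integration.integral_sum) auto
  finally show "expected_reward M n k X P \<le> (\<Sum>i\<in>{1..n}. integral\<^sup>L M (X i))" .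
qed

lemma adaptive_opt_bdd_above:
  assumes "k \<le> n"
    and "\<And>i. i \<in> {1..n} \<Longrightarrow> integrable M (X i)"
    and "\<And>i \<omega>. i \<in> {1..n} \<Longrightarrow> \<omega> \<in> space M \<Longrightarrow> 0 \<le> X i \<omega>"
  shows "bdd_above (expected_reward M n k X ` adaptive_policies n k)"
proof (rule bdd_aboveI2)
  show "expected_reward M n k X P \<le> (\<Sum>i\<in>{1..n}. integral\<^sup>L M (X i))"
    if "P \<in> adaptive_policies n k" for P
    using assms that by (intro expected_reward_le) auto
qed

end

theory Submission
  imports Defs
begin

text \<open>
  Run the policy on the values \<open>x\<close>, and on the same path of probes collect the maximum of an
  independent copy \<open>y\<close>. Let \<open>m\<close> be the running maximum of both and \<open>s\<close> that of the copy alone.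
  When index \<open>i\<close> is probed, \<open>m\<close> grows by at most \<open>(x\<^sub>i - m)\<^sup>+ + (y\<^sub>i - m)\<^sup>+\<close>. Given the past, \<open>x\<^sub>i\<close> and
  \<open>y\<^sub>i\<close> are identically distributed, so in expectation this is twice \<open>(y\<^sub>i - m)\<^sup>+ \<le> (y\<^sub>i - s)\<^sup>+\<close>, the
  growth of \<open>s\<close>. Hence the adaptive reward is at most twice the expected maximum of the copy along
  the path. But the path does not depend on \<open>y\<close>, so the latter is an average of expected maxima
  over fixed sets of size \<open>k\<close>.
\<close>

section \<open>Pathwise properties of the collected maximum\<close>

text \<open>Only \<open>x\<close> and \<open>r\<close> steer the choice of indices, while
  \<open>y\<close> and \<open>s\<close> are merely recorded. Recording \<open>x\<close> itself, an
  independent copy, or the pointwise maximum of the two gives the three quantities that the proof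
  compares.\<close>

fun shadow_reward ::
  "policy \<Rightarrow> (nat \<Rightarrow> real) \<Rightarrow> (nat \<Rightarrow> real) \<Rightarrow> nat \<Rightarrow> real \<Rightarrow> real \<Rightarrow> nat set \<Rightarrow> real" where
  "shadow_reward P x y 0 r s T = s"
| "shadow_reward P x y (Suc \<kappa>) r s T =
    (let i = P (Suc \<kappa>) r T in shadow_reward P x y \<kappa> (max r (x i)) (max s (y i)) (T - {i}))"

lemma probe_reward_eq_shadow_reward: "probe_reward P x \<kappa> r T = shadow_reward P x x \<kappa> r r T"
  by (induction \<kappa> arbitrary: r T) (auto simp: Let_def)

lemma shadow_reward_ge: "s \<le> shadow_reward P x y \<kappa> r s T"
proof (induction \<kappa> arbitrary: r s T)
  case (Suc \<kappa>)
  show ?case using Suc.IH[of "max s (y (P (Suc \<kappa>) r T))"] by (auto simp: Let_def)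
qed simp

text \<open>The path is the same on both sides because it depends only on \<open>x\<close> and
  \<open>r\<close>. This lets the reward be enlarged to the joint maximum of both copies along an
  unchanged path.\<close>

lemma shadow_reward_mono:
  assumes "\<And>i. y i \<le> y' i" "s \<le> s'"
  shows "shadow_reward P x y \<kappa> r s T \<le> shadow_reward P x y' \<kappa> r s' T"
  using assms(2)
proof (induction \<kappa> arbitrary: r s s' T)
  case (Suc \<kappa>)
  then show ?case using assms(1) by (auto simp: Let_def intro!: Suc.IH max.mono)
qed simp

context
  fixes P :: policy and n k :: nat
  assumes P: "P \<in> adaptive_policies n k"
begin

lemma policy_step:
  assumes "Suc \<kappa> \<le> k" "T \<subseteq> {1..n}" "Suc \<kappa> \<le> card T" "0 \<le> r" "i = P (Suc \<kappa>) r T"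
  shows "i \<in> T" "\<kappa> \<le> k" "T - {i} \<subseteq> {1..n}" "\<kappa> \<le> card (T - {i})"
proof -
  show "i \<in> T" using adaptive_policiesD(1)[OF P, of "Suc \<kappa>" T r] assms by auto
  moreover have "finite T" using assms finite_subset by blast
  ultimately show "\<kappa> \<le> k" "T - {i} \<subseteq> {1..n}" "\<kappa> \<le> card (T - {i})" using assms by auto
qed

text \<open>The policy chooses from \<open>T\<close>, so no coordinate outside \<open>T\<close> is
  ever read. In \<open>decoupling\<close> this makes the continuation blind to the values at an
  index already probed.\<close>

lemma shadow_reward_cong:
  assumes "\<kappa> \<le> k" "T \<subseteq> {1..n}" "\<kappa> \<le> card T" "0 \<le> r"
    and "\<And>i. i \<in> T \<Longrightarrow> x i = x' i" "\<And>i. i \<in> T \<Longrightarrow> y i = y' i"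
  shows "shadow_reward P x y \<kappa> r s T = shadow_reward P x' y' \<kappa> r s T"
  using assms
proof (induction \<kappa> arbitrary: r s T)
  case (Suc \<kappa>)
  define i where "i = P (Suc \<kappa>) r T"
  note i = policy_step[OF Suc.prems(1-4) i_def]
  have "shadow_reward P x y \<kappa> (max r (x i)) (max s (y i)) (T - {i}) =
      shadow_reward P x' y' \<kappa> (max r (x i)) (max s (y i)) (T - {i})"
    using Suc.prems i by (intro Suc.IH) auto
  then show ?case using Suc.prems(5,6)[OF i(1)] by (simp add: i_def Let_def)
qed simp

text \<open>\<open>S\<close> is the set of indices probed on the path. It is chosen before
  \<open>y\<close> and \<open>s\<close> are quantified, which is how the independence of the path
  from \<open>y\<close> is expressed.\<close>

lemma shadow_reward_eq_Max:
  assumes "\<kappa> \<le> k" "T \<subseteq> {1..n}" "\<kappa> \<le> card T" "0 \<le> r"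
  shows "\<exists>S\<subseteq>T. card S = \<kappa> \<and> (\<forall>y s. shadow_reward P x y \<kappa> r s T = Max (insert s (y ` S)))"
  using assms
proof (induction \<kappa> arbitrary: r T)
  case 0
  then show ?case by (intro exI[of _ "{}"]) auto
next
  case (Suc \<kappa>)
  define i where "i = P (Suc \<kappa>) r T"
  note i = policy_step[OF Suc.prems(1-4) i_def]
  obtain S where S: "S \<subseteq> T - {i}" "card S = \<kappa>"
    "\<And>y s. shadow_reward P x y \<kappa> (max r (x i)) s (T - {i}) = Max (insert s (y ` S))"
    using Suc.IH[OF i(2-4), of "max r (x i)"] max.coboundedI1[OF Suc.prems(4)] by blast
  have fin: "finite S" using subset_trans[OF S(1) i(3)] by (rule finite_subset) simp
  have "Max (insert (max s (y i)) (y ` S)) = Max (insert s (y ` insert i S))" for y :: "nat \<Rightarrow> real" and s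
    using fin by (cases "S = {}") (auto simp: max.assoc)
  moreover have "insert i S \<subseteq> T" "card (insert i S) = Suc \<kappa>"
    using S(1,2) i(1) fin by (auto simp: card_insert_if)
  ultimately show ?case using S(3)
    by (intro exI[of _ "insert i S"]) (simp add: i_def[symmetric] Let_def)
qed

lemma shadow_reward_measurable:
  assumes "\<kappa> \<le> k" "T \<subseteq> {1..n}" "\<kappa> \<le> card T"
    and "\<And>i. i \<in> T \<Longrightarrow> X i \<in> borel_measurable M" "\<And>i. i \<in> T \<Longrightarrow> Y i \<in> borel_measurable M"
    and "R \<in> borel_measurable M" "\<And>\<omega>. \<omega> \<in> space M \<Longrightarrow> 0 \<le> R \<omega>" "S \<in> borel_measurable M"
  shows "(\<lambda>\<omega>. shadow_reward P (\<lambda>i. X i \<omega>) (\<lambda>i. Y i \<omega>) \<kappa> (R \<omega>) (S \<omega>) T) \<in> borel_measurable M"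
  using assms
proof (induction \<kappa> arbitrary: R S T)
  case 0
  then show ?case by simp
next
  case (Suc \<kappa>)
  have fin: "finite T" using Suc.prems(2) finite_subset by blast
  have "R \<in> measurable M (restrict_space borel {0..})"
    using Suc.prems by (auto intro!: measurable_restrict_space2)
  from measurable_compose[OF this adaptive_policiesD(2)[OF P, of "Suc \<kappa>" T]]
  have g: "(\<lambda>\<omega>. P (Suc \<kappa>) (R \<omega>) T) \<in> measurable M (count_space UNIV)"
    using Suc.prems(1-3) by auto
  \<comment> \<open>The codomain is narrowed to \<open>T\<close> because the continuation is known
    to be measurable only after probes in \<open>T\<close>; the finitely many cases are then glued
    together.\<close>
  have g': "(\<lambda>\<omega>. P (Suc \<kappa>) (R \<omega>) T) \<in> measurable M (count_space T)"
    by (rule measurable_count_space_extend[OF _ _ g])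
      (use Suc.prems(1-3,7) policy_step(1) in auto)
  have f: "(\<lambda>\<omega>. shadow_reward P (\<lambda>i. X i \<omega>) (\<lambda>i. Y i \<omega>) \<kappa> (max (R \<omega>) (X i \<omega>))
      (max (S \<omega>) (Y i \<omega>)) (T - {i})) \<in> borel_measurable M" if "i \<in> T" for i
    using Suc.prems that fin by (intro Suc.IH) (auto simp: le_max_iff_disj)
  show ?case
    unfolding shadow_reward.simps Let_def
    by (rule measurable_compose_countable'[OF f g']) (auto intro: countable_finite fin)
qed

end

section \<open>Product measures over two copies of an index set\<close>

lemma measurable_PiM_Plus_update:
  assumes "i \<in> T" "a \<in> space (D i)" "b \<in> space (D i)"
  shows "(\<lambda>z. z(Inr i := b, Inl i := a)) \<in>
    measurable (PiM ((T - {i}) <+> (T - {i})) (case_sum D D)) (PiM (T <+> T) (case_sum D D))"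
proof -
  define J where "J = (T - {i}) <+> (T - {i})"
  have eq: "T <+> T = insert (Inr i) J \<union> {Inl i}" using assms(1) by (auto simp: J_def)
  have "(\<lambda>z. z(Inr i := b)) \<in> measurable (PiM J (case_sum D D)) (PiM (insert (Inr i) J) (case_sum D D))"
    by (rule measurable_fun_upd[where J=J]) (use assms in auto)
  then show ?thesis
    unfolding J_def[symmetric]
    by (rule measurable_fun_upd[OF eq]) (use assms in auto)
qed

text \<open>Fubini is applied twice, to \<open>Inl i\<close> and then to \<open>Inr i\<close>.
  \<open>Inl\<close> carries the values that the policy observes and \<open>Inr\<close> the copy.
  With the pair for the probed index outermost, both values are constants inside, as the induction
  in \<open>decoupling\<close> requires.\<close>

lemma nn_integral_PiM_Plus_remove:
  assumes D: "\<And>i. prob_space (D i)" and T: "finite T" "i \<in> T"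
    and F: "F \<in> borel_measurable (PiM (T <+> T) (case_sum D D))"
  shows "(\<integral>\<^sup>+z. F z \<partial>PiM (T <+> T) (case_sum D D)) =
    (\<integral>\<^sup>+a. \<integral>\<^sup>+b. \<integral>\<^sup>+z. F (z(Inr i := b, Inl i := a))
      \<partial>PiM ((T - {i}) <+> (T - {i})) (case_sum D D) \<partial>D i \<partial>D i)"
proof -
  interpret product_prob_space "case_sum D D" "T <+> T"
    using D by (intro product_prob_spaceI) (auto split: sum.split)
  define J where "J = (T - {i}) <+> (T - {i})"
  have eq: "T <+> T = insert (Inl i) (insert (Inr i) J)" using T by (auto simp: J_def)
  have J: "finite J" "Inl i \<notin> insert (Inr i) J" "Inr i \<notin> J" using T by (auto simp: J_def)
  note F' = F[unfolded eq]
  have "(\<integral>\<^sup>+z. F z \<partial>PiM (T <+> T) (case_sum D D)) =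
    (\<integral>\<^sup>+a. \<integral>\<^sup>+z. F (z(Inl i := a)) \<partial>PiM (insert (Inr i) J) (case_sum D D) \<partial>D i)"
    unfolding eq using J F' by (subst product_nn_integral_insert_rev) auto
  also have "\<dots> = (\<integral>\<^sup>+a. \<integral>\<^sup>+b. \<integral>\<^sup>+z. F (z(Inr i := b, Inl i := a)) \<partial>PiM J (case_sum D D) \<partial>D i \<partial>D i)"
  proof (rule nn_integral_cong)
    fix a assume a: "a \<in> space (D i)"
    have "(\<lambda>z. F (z(Inl i := a))) \<in> borel_measurable (PiM (insert (Inr i) J) (case_sum D D))"
      by (rule measurable_compose[OF _ F'], rule measurable_fun_upd[where J="insert (Inr i) J"])
         (use a in auto)
    then show "(\<integral>\<^sup>+z. F (z(Inl i := a)) \<partial>PiM (insert (Inr i) J) (case_sum D D)) =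
        (\<integral>\<^sup>+b. \<integral>\<^sup>+z. F (z(Inr i := b, Inl i := a)) \<partial>PiM J (case_sum D D) \<partial>D i)"
      using J by (subst product_nn_integral_insert_rev) auto
  qed
  finally show ?thesis by (simp add: J_def)
qed

text \<open>The marginals of a product of probability measures are its factors, so both copies of
  coordinate \<open>i\<close> have law \<open>D i\<close>. This equality of laws later turns two
  gains into twice one gain.\<close>

lemma nn_integral_PiM_Plus_component:
  assumes D: "\<And>i. prob_space (D i)" and T: "finite T" "i \<in> T"
    and f: "f \<in> borel_measurable (D i)"
  shows "(\<integral>\<^sup>+z. f (z (Inl i)) \<partial>PiM (T <+> T) (case_sum D D)) = (\<integral>\<^sup>+a. f a \<partial>D i)"
    "(\<integral>\<^sup>+z. f (z (Inr i)) \<partial>PiM (T <+> T) (case_sum D D)) = (\<integral>\<^sup>+a. f a \<partial>D i)"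
proof -
  interpret product_prob_space "case_sum D D" "T <+> T"
    using D by (intro product_prob_spaceI) (auto split: sum.split)
  have "(\<integral>\<^sup>+z. f (z j) \<partial>PiM (T <+> T) (case_sum D D)) = (\<integral>\<^sup>+a. f a \<partial>case_sum D D j)"
    if "j \<in> T <+> T" "f \<in> borel_measurable (case_sum D D j)" for j
  proof -
    have "(\<integral>\<^sup>+a. f a \<partial>distr (PiM (T <+> T) (case_sum D D)) (case_sum D D j) (\<lambda>z. z j)) =
        (\<integral>\<^sup>+z. f (z j) \<partial>PiM (T <+> T) (case_sum D D))"
      using that by (intro nn_integral_distr) auto
    then show ?thesis using PiM_component[OF that(1)] by simp
  qed
  from this[of "Inl i"] this[of "Inr i"] T f
  show "(\<integral>\<^sup>+z. f (z (Inl i)) \<partial>PiM (T <+> T) (case_sum D D)) = (\<integral>\<^sup>+a. f a \<partial>D i)"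
    "(\<integral>\<^sup>+z. f (z (Inr i)) \<partial>PiM (T <+> T) (case_sum D D)) = (\<integral>\<^sup>+a. f a \<partial>D i)" by auto
qed

section \<open>The decoupling inequality\<close>

text \<open>
  Both sides are stated as increments, so that the induction only adds non-negative integrals and
  needs no integrability.
\<close>

lemma decoupling:
  fixes D :: "nat \<Rightarrow> real measure"
  assumes P: "P \<in> adaptive_policies n k"
    and D: "\<And>i. prob_space (D i)" "\<And>i. sets (D i) = sets borel"
    and "\<kappa> \<le> k" "T \<subseteq> {1..n}" "\<kappa> \<le> card T" "0 \<le> r" "s \<le> m"
  shows "(\<integral>\<^sup>+z. ennreal (shadow_reward P (\<lambda>i. z (Inl i)) (\<lambda>i. max (z (Inl i)) (z (Inr i))) \<kappa> r m T - m)
        \<partial>PiM (T <+> T) (case_sum D D))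
    \<le> 2 * (\<integral>\<^sup>+z. ennreal (shadow_reward P (\<lambda>i. z (Inl i)) (\<lambda>i. z (Inr i)) \<kappa> r s T - s)
        \<partial>PiM (T <+> T) (case_sum D D))"
  using assms(4-8)
proof (induction \<kappa> arbitrary: r s m T)
  case 0
  then show ?case by simp
next
  case (Suc \<kappa>)
  define i where "i = P (Suc \<kappa>) r T"
  note i = policy_step[OF P Suc.prems(1-4) i_def]
  have fin: "finite T" using Suc.prems(2) finite_subset by blast
  define T' where "T' = T - {i}"
  have T': "T' \<subseteq> T" "T' \<subseteq> {1..n}" "\<kappa> \<le> card T'" using i by (auto simp: T'_def)
  define N where "N = PiM (T <+> T) (case_sum D D)"
  have "(\<lambda>z. z j) \<in> borel_measurable N" if "j \<in> T <+> T" for j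
  proof -
    have "(\<lambda>z. z j) \<in> measurable N (case_sum D D j)"
      unfolding N_def by (rule measurable_component_singleton[OF that])
    moreover have "sets (case_sum D D j) = sets borel" using D(2) by (auto split: sum.split)
    ultimately show ?thesis by (simp cong: measurable_cong_sets)
  qed
  then have meas[measurable]: "(\<lambda>z. z (Inl j)) \<in> borel_measurable N" "(\<lambda>z. z (Inr j)) \<in> borel_measurable N"
    if "j \<in> T" for j using that by auto
  note meas_i[measurable] = meas[OF i(1)]
  define x y w :: "(nat + nat \<Rightarrow> real) \<Rightarrow> nat \<Rightarrow> real"
    where xyw: "x = (\<lambda>z j. z (Inl j))" "y = (\<lambda>z j. z (Inr j))" "w = (\<lambda>z j. max (z (Inl j)) (z (Inr j)))"
  \<comment> \<open>\<open>A\<close> and \<open>B\<close> are the gains made after the probe of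
    \<open>i\<close>, measured from the updated running maxima; this is the shape of the induction
    hypothesis.\<close>
  define A where "A z = shadow_reward P (x z) (w z) \<kappa> (max r (x z i)) (max m (w z i)) T' - max m (w z i)" for z
  define B where "B z = shadow_reward P (x z) (y z) \<kappa> (max r (x z i)) (max s (y z i)) T' - max s (y z i)" for z
  have nonneg: "0 \<le> A z" "0 \<le> B z" for z
    by (simp_all add: A_def B_def shadow_reward_ge)
  have [measurable]: "A \<in> borel_measurable N" "B \<in> borel_measurable N"
    unfolding A_def[abs_def] B_def[abs_def] xyw using i(1,2) T' Suc.prems(4)
    by (auto intro!: borel_measurable_diff shadow_reward_measurable[OF P] meas borel_measurable_max)
  have IH: "(\<integral>\<^sup>+z. ennreal (A z) \<partial>N) \<le> (\<integral>\<^sup>+z. 2 * ennreal (B z) \<partial>N)"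
  proof -
    have neq: "j \<noteq> i" if "j \<in> T'" for j using that by (auto simp: T'_def)
    \<comment> \<open>The remaining probes avoid \<open>i\<close>, so overwriting its two
      coordinates changes only the accumulators, which no longer depend on \<open>z\<close>.\<close>
    have upd: "A (z(Inr i := b, Inl i := a)) =
        shadow_reward P (x z) (w z) \<kappa> (max r a) (max m (max a b)) T' - max m (max a b)"
      "B (z(Inr i := b, Inl i := a)) =
        shadow_reward P (x z) (y z) \<kappa> (max r a) (max s b) T' - max s b" for z a b
      unfolding A_def B_def xyw using i T' Suc.prems(4)
      by (auto dest: neq intro!: shadow_reward_cong[OF P])
    have "(\<integral>\<^sup>+z. ennreal (A z) \<partial>N) = (\<integral>\<^sup>+a. \<integral>\<^sup>+b. \<integral>\<^sup>+z. ennreal (A (z(Inr i := b, Inl i := a)))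
        \<partial>PiM (T' <+> T') (case_sum D D) \<partial>D i \<partial>D i)"
      unfolding N_def T'_def using i fin
      by (intro nn_integral_PiM_Plus_remove D) (auto simp: N_def[symmetric])
    \<comment> \<open>The induction hypothesis is used with \<open>max s b\<close> and
      \<open>max m (max a b)\<close> for \<open>s\<close> and \<open>m\<close>. Their order survives
      because the joint maximum also contains \<open>b\<close>.\<close>
    also have "\<dots> \<le> (\<integral>\<^sup>+a. \<integral>\<^sup>+b. 2 * (\<integral>\<^sup>+z. ennreal (B (z(Inr i := b, Inl i := a)))
        \<partial>PiM (T' <+> T') (case_sum D D)) \<partial>D i \<partial>D i)"
      unfolding upd using i T' Suc.prems(4,5) unfolding xyw
      by (intro nn_integral_mono Suc.IH) auto
    also have "\<dots> = (\<integral>\<^sup>+a. \<integral>\<^sup>+b. (\<integral>\<^sup>+z. 2 * ennreal (B (z(Inr i := b, Inl i := a)))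
        \<partial>PiM (T' <+> T') (case_sum D D)) \<partial>D i \<partial>D i)"
    proof (intro nn_integral_cong nn_integral_cmult[symmetric])
      fix a b
      have "(\<lambda>z. z(Inr i := b, Inl i := a)) \<in> measurable (PiM (T' <+> T') (case_sum D D)) N"
        unfolding N_def T'_def using i(1) sets_eq_imp_space_eq[OF D(2)]
        by (intro measurable_PiM_Plus_update) auto
      then show "(\<lambda>z. ennreal (B (z(Inr i := b, Inl i := a))))
          \<in> borel_measurable (PiM (T' <+> T') (case_sum D D))"
        by (rule measurable_compose) measurable
    qed
    also have "\<dots> = (\<integral>\<^sup>+z. 2 * ennreal (B z) \<partial>N)"
      unfolding N_def T'_def using i fin
      by (intro nn_integral_PiM_Plus_remove[symmetric] D) (auto simp: N_def[symmetric])
    finally show ?thesis .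
  qed
  \<comment> \<open>The positive part of \<open>a - m\<close>: how far a single value exceeds the
    old joint maximum.\<close>
  let ?p = "\<lambda>a. ennreal (max m a - m)"
  have pm: "?p \<in> borel_measurable (D i)"
    using D(2) by (simp cong: measurable_cong_sets)
  have "(\<integral>\<^sup>+z. ennreal (shadow_reward P (x z) (w z) (Suc \<kappa>) r m T - m) \<partial>N)
    \<le> (\<integral>\<^sup>+z. ennreal (A z) + (?p (x z i) + ?p (y z i)) \<partial>N)"
  proof (rule nn_integral_mono)
    fix z
    \<comment> \<open>The rise from \<open>m\<close> to \<open>max m (w z i)\<close> is at most the
      sum of the rises caused by the two values separately.\<close>
    have "shadow_reward P (x z) (w z) (Suc \<kappa>) r m T - m \<le> A z + ((max m (x z i) - m) + (max m (y z i) - m))"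
      by (auto simp: A_def i_def[symmetric] T'_def Let_def xyw)
    then show "ennreal (shadow_reward P (x z) (w z) (Suc \<kappa>) r m T - m)
        \<le> ennreal (A z) + (?p (x z i) + ?p (y z i))"
      using nonneg[of z] by (simp add: ennreal_leI flip: ennreal_plus)
  qed
  also have "\<dots> = (\<integral>\<^sup>+z. ennreal (A z) \<partial>N) + ((\<integral>\<^sup>+z. ?p (x z i) \<partial>N) + (\<integral>\<^sup>+z. ?p (y z i) \<partial>N))"
    unfolding xyw by (simp add: nn_integral_add)
  \<comment> \<open>The index \<open>i\<close> and the threshold \<open>m\<close> are fixed before
    the two values at \<open>i\<close> are seen, so both gains have the same mean. This symmetry
    produces the factor 2.\<close>
  also have "(\<integral>\<^sup>+z. ?p (x z i) \<partial>N) = (\<integral>\<^sup>+z. ?p (y z i) \<partial>N)"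
    unfolding xyw N_def using nn_integral_PiM_Plus_component[where D=D and f="?p", OF D(1) fin i(1) pm] by simp
  also have "(\<integral>\<^sup>+z. ennreal (A z) \<partial>N) + ((\<integral>\<^sup>+z. ?p (y z i) \<partial>N) + (\<integral>\<^sup>+z. ?p (y z i) \<partial>N))
      \<le> (\<integral>\<^sup>+z. 2 * ennreal (B z) \<partial>N) + 2 * (\<integral>\<^sup>+z. ?p (y z i) \<partial>N)"
    using IH by (simp add: mult_2 add_right_mono)
  also have "\<dots> = 2 * (\<integral>\<^sup>+z. ennreal (B z) + ?p (y z i) \<partial>N)"
    unfolding xyw by (simp add: nn_integral_add nn_integral_cmult distrib_left)
  also have "\<dots> \<le> 2 * (\<integral>\<^sup>+z. ennreal (shadow_reward P (x z) (y z) (Suc \<kappa>) r s T - s) \<partial>N)"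
  proof (intro mult_left_mono nn_integral_mono)
    fix z
    \<comment> \<open>Lowering the threshold from \<open>m\<close> to \<open>s\<close> can only
      enlarge the gain from \<open>y z i\<close>.\<close>
    have "B z + (max m (y z i) - m) \<le> shadow_reward P (x z) (y z) (Suc \<kappa>) r s T - s"
      using Suc.prems(5) by (auto simp: B_def i_def[symmetric] T'_def Let_def)
    then show "ennreal (B z) + ?p (y z i) \<le> ennreal (shadow_reward P (x z) (y z) (Suc \<kappa>) r s T - s)"
      using nonneg[of z] by (simp add: ennreal_leI flip: ennreal_plus)
  qed simp
  finally show ?case by (simp add: N_def xyw)
qed

section \<open>Two independent sample points as a model of the product measure\<close>

text \<open>The point \<open>u\<close> supplies the observed values and \<open>v\<close> the copy.
  It suffices to compare boxes: the pair measure separates the two halves, and independence of the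
  \<open>X i\<close> factorises each half.\<close>

lemma (in prob_space) distr_pair_eq_PiM_Plus:
  assumes ind: "indep_vars (\<lambda>_. N) X I" and I: "finite I"
    and D: "\<And>i. prob_space (D i)" "\<And>i. i \<in> I \<Longrightarrow> D i = distr M N (X i)"
  shows "distr (M \<Otimes>\<^sub>M M) (PiM (I <+> I) (case_sum D D))
      (\<lambda>(u, v). \<lambda>j\<in>I <+> I. case j of Inl i \<Rightarrow> X i u | Inr i \<Rightarrow> X i v) = PiM (I <+> I) (case_sum D D)"
    (is "distr _ ?P ?f = _")
    and "(\<lambda>(u, v). \<lambda>j\<in>I <+> I. case j of Inl i \<Rightarrow> X i u | Inr i \<Rightarrow> X i v)
      \<in> measurable (M \<Otimes>\<^sub>M M) (PiM (I <+> I) (case_sum D D))"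
proof -
  interpret PP: product_prob_space "case_sum D D" "I <+> I"
    using D by (intro product_prob_spaceI) (auto split: sum.split)
  interpret MM: pair_prob_space M M ..
  have X: "X i \<in> measurable M N" if "i \<in> I" for i
    using ind that by (auto simp: indep_vars_def)
  have sD: "sets (D i) = sets N" if "i \<in> I" for i using D(2)[OF that] by simp
  have X': "X i \<in> measurable M (D i)" if "i \<in> I" for i
    using X[OF that] sD[OF that] by (simp cong: measurable_cong_sets)
  show f: "?f \<in> measurable (M \<Otimes>\<^sub>M M) ?P"
    unfolding case_prod_beta
    by (rule measurable_restrict)
      (auto intro: measurable_compose[OF measurable_fst X'] measurable_compose[OF measurable_snd X'])
  show "distr (M \<Otimes>\<^sub>M M) ?P ?f = ?P"
  proof (rule PP.PiM_eqI)
    show "finite (I <+> I)" using I by simp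
    show "sets (distr (M \<Otimes>\<^sub>M M) ?P ?f) = sets ?P" by simp
    fix A assume A: "\<And>j. j \<in> I <+> I \<Longrightarrow> A j \<in> sets (case_sum D D j)"
    then have AI: "A (Inl i) \<in> sets N" "A (Inr i) \<in> sets N" if "i \<in> I" for i
      using sD[OF that] that by (metis InlI InrI sum.case)+
    have box: "emeasure M {u\<in>space M. \<forall>i\<in>I. X i u \<in> E i} = (\<Prod>i\<in>I. emeasure (D i) (E i))"
      "{u\<in>space M. \<forall>i\<in>I. X i u \<in> E i} \<in> sets M"
      if E: "\<And>i. i \<in> I \<Longrightarrow> E i \<in> sets N" for E
    proof -
      show "{u\<in>space M. \<forall>i\<in>I. X i u \<in> E i} \<in> sets M"
        using I X E by (auto intro!: sets.sets_Collect_finite_All measurable_sets_Collect)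
      show "emeasure M {u\<in>space M. \<forall>i\<in>I. X i u \<in> E i} = (\<Prod>i\<in>I. emeasure (D i) (E i))"
      proof (cases "I = {}")
        case True then show ?thesis by (simp add: emeasure_space_1)
      next
        case False
        have "prob (\<Inter>i\<in>I. X i -` E i \<inter> space M) = (\<Prod>i\<in>I. prob (X i -` E i \<inter> space M))"
          by (rule indep_varsD_finite[OF ind False I]) (use E in auto)
        moreover have "(\<Inter>i\<in>I. X i -` E i \<inter> space M) = {u\<in>space M. \<forall>i\<in>I. X i u \<in> E i}"
          using False by auto
        moreover have "emeasure (D i) (E i) = prob (X i -` E i \<inter> space M)" if "i \<in> I" for i
          using that X E D(2) by (simp add: emeasure_distr emeasure_eq_measure)
        ultimately show ?thesis by (simp add: emeasure_eq_measure prod_ennreal)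
      qed
    qed
    have pre: "?f -` Pi\<^sub>E (I <+> I) A \<inter> space (M \<Otimes>\<^sub>M M) =
        {u\<in>space M. \<forall>i\<in>I. X i u \<in> A (Inl i)} \<times> {u\<in>space M. \<forall>i\<in>I. X i u \<in> A (Inr i)}"
      by (auto simp: space_pair_measure PiE_iff Plus_def ball_Un)
    have "emeasure (distr (M \<Otimes>\<^sub>M M) ?P ?f) (Pi\<^sub>E (I <+> I) A) =
        (\<Prod>i\<in>I. emeasure (D i) (A (Inl i))) * (\<Prod>i\<in>I. emeasure (D i) (A (Inr i)))"
      using f I A AI by (subst emeasure_distr)
        (auto intro!: sets_PiM_I_finite simp: pre emeasure_pair_measure_Times box)
    also have "\<dots> = (\<Prod>j\<in>I <+> I. emeasure (case_sum D D j) (A j))"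
      unfolding Plus_def using I by (subst prod.union_disjoint) (auto simp: prod.reindex)
    finally show "emeasure (distr (M \<Otimes>\<^sub>M M) ?P ?f) (Pi\<^sub>E (I <+> I) A) =
      (\<Prod>j\<in>I <+> I. emeasure (case_sum D D j) (A j))" .
  qed
qed

section \<open>Comparison with fixed sets of probes\<close>

lemma nonadaptive_opt_ge:
  assumes "S \<subseteq> {1..n}" "card S = k"
  shows "(\<integral>\<omega>. (MAX i\<in>S. X i \<omega>) \<partial>M) \<le> nonadaptive_opt M n k X"
  unfolding nonadaptive_opt_def using assms by (intro Max_ge) auto

theorem theorem2:
  fixes M :: "'a measure" and X :: "nat \<Rightarrow> 'a \<Rightarrow> real" and n k :: nat
  assumes "prob_space M"
    and "1 \<le> k" and "k \<le> n"
    and "prob_space.indep_vars M (\<lambda>_. borel) X {1..n}"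
    and "\<And>i \<omega>. i \<in> {1..n} \<Longrightarrow> \<omega> \<in> space M \<Longrightarrow> 0 \<le> X i \<omega>"
    and "\<And>i. i \<in> {1..n} \<Longrightarrow> integrable M (X i)"
  shows "adaptive_opt M n k X \<le> 2 * nonadaptive_opt M n k X"
proof -
  interpret prob_space M by fact
  interpret MM: pair_prob_space M M ..
  define I where "I = {1..n}"
  \<comment> \<open>The point mass outside \<open>I\<close> is a default: the product lemmas ask for
    a probability measure at every index.\<close>
  define D where "D i = (if i \<in> I then distr M borel (X i) else return borel 0)" for i
  have Xm: "X i \<in> borel_measurable M" if "i \<in> I" for i
    using assms(6) that by (auto simp: I_def)
  have D: "prob_space (D i)" "sets (D i) = sets borel" for i
    using Xm by (auto simp: D_def intro!: prob_space_distr prob_space_return)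
  define Q where "Q = PiM (I <+> I) (case_sum D D)"
  define f where "f = (\<lambda>(u, v). \<lambda>j\<in>I <+> I. case j of Inl i \<Rightarrow> X i u | Inr i \<Rightarrow> X i v)"
  have f: "f \<in> measurable (M \<Otimes>\<^sub>M M) Q" and Q: "distr (M \<Otimes>\<^sub>M M) Q f = Q"
    unfolding Q_def f_def using assms(4) D
    by (auto intro!: distr_pair_eq_PiM_Plus simp: I_def[symmetric], simp_all add: D_def I_def)
  have Q_eq: "(\<integral>\<^sup>+w. F (f w) \<partial>(M \<Otimes>\<^sub>M M)) = (\<integral>\<^sup>+z. F z \<partial>Q)" if "F \<in> borel_measurable Q" for F
    using nn_integral_distr[OF f, of F] that by (simp add: Q)
  have f_apply: "f (u, v) (Inl i) = X i u" "f (u, v) (Inr i) = X i v" if "i \<in> I" for u v i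
    using that by (auto simp: f_def)
  \<comment> \<open>The bound is derived in \<open>ennreal\<close>; this sign lets it be read back
    over the reals.\<close>
  have nn: "0 \<le> nonadaptive_opt M n k X"
  proof -
    have "0 \<le> (\<integral>\<omega>. (MAX i\<in>{1..k}. X i \<omega>) \<partial>M)"
      using assms(2,3,5) by (intro integral_nonneg_AE AE_I2) (auto simp: Max_ge_iff intro!: bexI[of _ 1])
    also have "\<dots> \<le> nonadaptive_opt M n k X"
      using assms(3) by (intro nonadaptive_opt_ge) auto
    finally show ?thesis .
  qed
  have "expected_reward M n k X P \<le> 2 * nonadaptive_opt M n k X" if P: "P \<in> adaptive_policies n k" for P
  proof -
    let ?S = "\<lambda>x y. shadow_reward P x y k 0 0 I"
    have k: "k \<le> k" "I \<subseteq> {1..n}" "k \<le> card I" using assms(3) by (auto simp: I_def)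
    have Qm: "(\<lambda>z. z j) \<in> borel_measurable Q" if "j \<in> I <+> I" for j
    proof -
      have "(\<lambda>z. z j) \<in> measurable Q (case_sum D D j)"
        unfolding Q_def by (rule measurable_component_singleton[OF that])
      moreover have "sets (case_sum D D j) = sets borel" using D(2) by (auto split: sum.split)
      ultimately show ?thesis by (simp cong: measurable_cong_sets)
    qed
    have "ennreal (expected_reward M n k X P) =
        (\<integral>\<^sup>+u. ennreal (probe_reward P (\<lambda>i. X i u) k 0 {1..n}) \<partial>M)"
      unfolding expected_reward_def
      using probe_reward_integrable[OF assms(3) P assms(6,5)]
        probe_reward_bounds[OF P _ _ _ _ assms(5)] assms(3)
      by (intro nn_integral_eq_integral[symmetric]) auto
    \<comment> \<open>The integrand ignores \<open>v\<close>. As \<open>M\<close> has total mass 1,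
      this dummy integration moves the reward to the pair space.\<close>
    also have "\<dots> = (\<integral>\<^sup>+u. \<integral>\<^sup>+v. ennreal (?S (\<lambda>i. X i u) (\<lambda>i. X i u)) \<partial>M \<partial>M)"
      by (simp add: probe_reward_eq_shadow_reward I_def emeasure_space_1)
    also have "\<dots> = (\<integral>\<^sup>+(u, v). ennreal (?S (\<lambda>i. X i u) (\<lambda>i. X i u)) \<partial>(M \<Otimes>\<^sub>M M))"
      using shadow_reward_measurable[OF P k, of "\<lambda>i w. X i (fst w)" "M \<Otimes>\<^sub>M M" "\<lambda>i w. X i (fst w)" "\<lambda>_. 0" "\<lambda>_. 0"] Xm
      by (subst nn_integral_fst[symmetric]) (auto simp: case_prod_beta)
    also have "\<dots> = (\<integral>\<^sup>+w. ennreal (?S (\<lambda>i. f w (Inl i)) (\<lambda>i. f w (Inl i))) \<partial>(M \<Otimes>\<^sub>M M))"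
      using k by (intro nn_integral_cong) (auto simp: f_apply intro!: arg_cong[of _ _ ennreal] shadow_reward_cong[OF P])
    also have "\<dots> \<le> (\<integral>\<^sup>+w. ennreal (?S (\<lambda>i. f w (Inl i)) (\<lambda>i. max (f w (Inl i)) (f w (Inr i)))) \<partial>(M \<Otimes>\<^sub>M M))"
      by (intro nn_integral_mono ennreal_leI shadow_reward_mono) auto
    also have "\<dots> = (\<integral>\<^sup>+z. ennreal (?S (\<lambda>i. z (Inl i)) (\<lambda>i. max (z (Inl i)) (z (Inr i)))) \<partial>Q)"
      using k Qm by (intro Q_eq)
        (auto intro!: measurable_compose[OF _ measurable_ennreal] shadow_reward_measurable[OF P] borel_measurable_max)
    \<comment> \<open>With all accumulators starting at 0, the increments in
      \<open>decoupling\<close> are the collected maxima themselves.\<close>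
    also have "\<dots> \<le> 2 * (\<integral>\<^sup>+z. ennreal (?S (\<lambda>i. z (Inl i)) (\<lambda>i. z (Inr i))) \<partial>Q)"
      using decoupling[OF P D k, of 0 0 0] by (simp add: Q_def)
    also have "(\<integral>\<^sup>+z. ennreal (?S (\<lambda>i. z (Inl i)) (\<lambda>i. z (Inr i))) \<partial>Q) =
        (\<integral>\<^sup>+w. ennreal (?S (\<lambda>i. f w (Inl i)) (\<lambda>i. f w (Inr i))) \<partial>(M \<Otimes>\<^sub>M M))"
      using k Qm by (intro Q_eq[symmetric])
        (auto intro!: measurable_compose[OF _ measurable_ennreal] shadow_reward_measurable[OF P])
    also have "\<dots> = (\<integral>\<^sup>+(u, v). ennreal (?S (\<lambda>i. X i u) (\<lambda>i. X i v)) \<partial>(M \<Otimes>\<^sub>M M))"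
      using k by (intro nn_integral_cong) (auto simp: f_apply intro!: arg_cong[of _ _ ennreal] shadow_reward_cong[OF P])
    also have "\<dots> = (\<integral>\<^sup>+u. \<integral>\<^sup>+v. ennreal (?S (\<lambda>i. X i u) (\<lambda>i. X i v)) \<partial>M \<partial>M)"
      using shadow_reward_measurable[OF P k, of "\<lambda>i w. X i (fst w)" "M \<Otimes>\<^sub>M M" "\<lambda>i w. X i (snd w)" "\<lambda>_. 0" "\<lambda>_. 0"] Xm
      by (subst nn_integral_fst[symmetric]) (auto simp: case_prod_beta)
    also have "\<dots> \<le> (\<integral>\<^sup>+u. ennreal (nonadaptive_opt M n k X) \<partial>M)"
    proof (rule nn_integral_mono)
      fix u
      \<comment> \<open>Fixing \<open>u\<close> fixes the path and hence the probed set
        \<open>S\<close>, leaving the expectation over \<open>v\<close> of a maximum over a fixed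
        set. \<open>S\<close> may vary with \<open>u\<close>, but the bound does not.\<close>
      obtain S where S: "S \<subseteq> I" "card S = k"
        "\<And>y s. shadow_reward P (\<lambda>i. X i u) y k 0 s I = Max (insert s (y ` S))"
        using shadow_reward_eq_Max[OF P k, of 0 "\<lambda>i. X i u"] by auto
      have S': "finite S" "S \<noteq> {}" using S(1,2) assms(2) finite_subset by (auto simp: I_def)
      have pos: "0 \<le> (MAX i\<in>S. X i v)" if "v \<in> space M" for v
      proof -
        obtain j where j: "j \<in> S" using S' by blast
        then have "0 \<le> X j v" using S(1) that by (intro assms(5)) (auto simp: I_def)
        also have "\<dots> \<le> (MAX i\<in>S. X i v)" using j S' by (intro Max_ge) auto
        finally show ?thesis .
      qed
      \<comment> \<open>The starting value 0 drops out of the maximum, since \<open>S\<close> is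
        non-empty by \<open>1 \<le> k\<close> and the values are non-negative.\<close>
      have "(\<integral>\<^sup>+v. ennreal (?S (\<lambda>i. X i u) (\<lambda>i. X i v)) \<partial>M) = (\<integral>\<^sup>+v. ennreal (MAX i\<in>S. X i v) \<partial>M)"
        using S' pos by (intro nn_integral_cong) (auto simp: S(3) max_def)
      also have "\<dots> = ennreal (\<integral>v. (MAX i\<in>S. X i v) \<partial>M)"
      proof (rule nn_integral_eq_integral)
        show "integrable M (\<lambda>v. MAX i\<in>S. X i v)"
          using S' S(1) assms(6) unfolding I_def by (intro integrable_MAX) auto
      qed (use pos in auto)
      also have "\<dots> \<le> ennreal (nonadaptive_opt M n k X)"
        using S by (intro ennreal_leI nonadaptive_opt_ge) (auto simp: I_def)
      finally show "(\<integral>\<^sup>+v. ennreal (?S (\<lambda>i. X i u) (\<lambda>i. X i v)) \<partial>M) \<le> ennreal (nonadaptive_opt M n k X)" .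
    qed
    also have "\<dots> = ennreal (nonadaptive_opt M n k X)" by (simp add: emeasure_space_1)
    finally have "ennreal (expected_reward M n k X P) \<le> ennreal (2 * nonadaptive_opt M n k X)"
      by (simp add: ennreal_mult' mult_left_mono)
    then show ?thesis using nn by (subst (asm) ennreal_le_iff) auto
  qed
  then show ?thesis
    unfolding adaptive_opt_def by (intro cSUP_least adaptive_policies_nonempty)
qed

end
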